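(* For any $0<\eta<1/2$ and any integer $N=2^k$, identify $[N]$ with the group $\mathbb F_2^k$ with group operation $\oplus$. There is a Unique Games instance $\mathcal U_\eta=(G(V,E),[N],\{\pi_e\}_{e\in E},{\rm wt})$ together with, for every vertex $v\in V$, vectors $v_1,\dots,v_N\in\mathbb R^N$ (the SDP vectors being $v_i^{\otimes 2}$), such that: (1) $|V|=\tilde n=2^N/N$ and ${\rm opt}(\mathcal U_\eta)\le(\log\tilde n)^{-\eta}$; (2) for every $v\in V$, $\{v_i\}_{i\in[N]}$ is an orthonormal basis of $\mathbb R^N$; (3) for any $u,v,w\in V$ and $i,j,\ell\in[N]$, $1+\langle u_i,v_j\rangle\ge\langle u_i,w_\ell\rangle+\langle v_j,w_\ell\rangle$; (4) for any $v,w\in V$ and $i,j,\ell\in[N]$, $\langle v_i,w_j\rangle=\langle v_{i\oplus\ell},w_{j\oplus\ell}\rangle$; (5) for any edge $e\{v,w\}\in E$ there are $i_0,j_0\in[N]$ with $\langle v_{i_0},w_{j_0}\rangle\ge1-4\eta$ and $i_0\oplus\ell=\pi_e(j_0\oplus\ell)$ for all $\ell\in[N]$.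
   Context: A Unique Games instance $(G(V,E),[N],\{\pi_e\},{\rm wt})$ consists of a graph, for each edge $e\{v,w\}$ a bijection $\pi_e:[N]\to[N]$ and weight ${\rm wt}(e)>0$ with $\sum_e{\rm wt}(e)=1$. A labeling $\lambda:V\to[N]$ satisfies $e\{v,w\}$ if $\lambda(v)=\pi_e(\lambda(w))$; ${\rm opt}$ is the maximum total weight of edges satisfied by a labeling. Here, for a vertex named $v$ (resp. $u,w$), its associated vectors are written $v_i$ (resp. $u_i,w_i$). Logarithms are base 2.
   Formalization: The claim is proved for every N = 2^k that is sufficiently large depending on η, not for any N = 2^k; as stated it fails, e.g. for N = 4 and η < 1/64, where (2)–(5) force opt = 1 > (log ñ)^{-η}. *)

theory Defs
  imports Graph_Theory.Digraph Jordan_Normal_Form.VS_Connect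
begin

unbundle bit_operations_syntax

text \<open>
  A Unique Games instance on a finite undirected multigraph (parallel edges allowed, no loops).
  An edge \<open>e{v,w}\<close> is an arc with \<open>v = tail G e\<close> and \<open>w = head G e\<close>: the orientation is
  arbitrary and only records in which direction the permutation \<open>\<pi> e\<close> is read.
  The label set \<open>[N]\<close> is \<open>{..<N}\<close>; for \<open>N = 2 ^ k\<close> it is identified with
  \<open>F\<^sub>2\<^sup>k\<close> via binary digits, so that the group operation is \<open>XOR\<close>.
\<close>

locale unique_games = fin_digraph G + loopfree_digraph G
  for G :: "('v, 'e) pre_digraph" (structure) +
  fixes N :: nat
    and \<pi> :: "'e \<Rightarrow> nat \<Rightarrow> nat"
    and wt :: "'e \<Rightarrow> real"
  assumes bij_perm: "e \<in> arcs G \<Longrightarrow> bij_betw (\<pi> e) {..<N} {..<N}"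
    and wt_pos: "e \<in> arcs G \<Longrightarrow> wt e > 0"
    and sum_wt: "(\<Sum>e\<in>arcs G. wt e) = 1"

definition satisfied_edges ::
  "('v, 'e) pre_digraph \<Rightarrow> ('e \<Rightarrow> nat \<Rightarrow> nat) \<Rightarrow> ('v \<Rightarrow> nat) \<Rightarrow> 'e set"
where
  "satisfied_edges G \<pi> lab = {e \<in> arcs G. lab (tail G e) = \<pi> e (lab (head G e))}"

definition ug_opt ::
  "('v, 'e) pre_digraph \<Rightarrow> nat \<Rightarrow> ('e \<Rightarrow> nat \<Rightarrow> nat) \<Rightarrow> ('e \<Rightarrow> real) \<Rightarrow> real"
where
  "ug_opt G N \<pi> wt =
     Max ((\<lambda>lab. \<Sum>e\<in>satisfied_edges G \<pi> lab. wt e) ` (verts G \<rightarrow>\<^sub>E {..<N}))"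

definition orthonormal_basis :: "nat \<Rightarrow> (nat \<Rightarrow> real vec) \<Rightarrow> bool" where
  "orthonormal_basis N b \<longleftrightarrow>
     vectorspace.basis class_ring (module_vec TYPE(real) N) (b ` {..<N}) \<and>
     (\<forall>i<N. \<forall>j<N. b i \<bullet> b j = (if i = j then 1 else 0))"

end

theory Submission
  imports Defs "HOL-Library.Indicator_Function"
begin

text \<open>
  The instance is the quotient of the noise graph on the functions
  \<open>f : F\<^sub>2\<^sup>k \<rightarrow> {1, -1}\<close> by multiplication with the \<open>N\<close> characters: a vertex is a class of
  functions, its vectors are its \<open>N\<close> members scaled by \<open>1 / sqrt N\<close>, and an edge joins \<open>f\<close> to a
  noisy copy of \<open>f\<close> in which each value is flipped with probability \<open>\<eta>\<close>. A labeling selects one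
  function from each class, hence a set \<open>A\<close> of density \<open>1 / N\<close>, and the weight of the satisfied
  edges is \<open>N\<close> times the probability that a random \<open>f\<close> and its noisy copy both lie in \<open>A\<close>.
  Hypercontractivity bounds this by \<open>N powr (1 - 1 / (1 - \<eta>)) = N powr (- \<eta> / (1 - \<eta>))\<close>, which
  leaves room for the factor lost by conditioning on noise that flips at most \<open>2 \<eta> N\<close> values and is
  not itself a character (the latter would give loops).
\<close>

section \<open>The two-point inequality\<close>

text \<open>Bernoulli's inequality for exponents in [0,1]: the difference of the sides vanishes at 0
  and has derivative \<open>s * (1 - (1 + t) powr (s - 1))\<close>, where the exponent
  \<open>s - 1\<close> is at most 0.\<close>

lemma powr_one_plus_le:
  fixes s x :: real
  assumes s: "0 \<le> s" "s \<le> 1" and x: "0 \<le> x"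
  shows "(1 + x) powr s \<le> 1 + s * x"
proof -
  define h where "h = (\<lambda>t::real. 1 + s * t - (1 + t) powr s)"
  have "h 0 \<le> h x"
  proof (rule DERIV_nonneg_imp_nondecreasing[OF x])
    fix t assume t: "0 \<le> t" "t \<le> x"
    have "(h has_real_derivative s * (1 - (1 + t) powr (s - 1))) (at t)"
      unfolding h_def using t by (auto intro!: derivative_eq_intros simp: powr_diff algebra_simps)
    moreover have "(1 + t) powr (s - 1) \<le> 1"
      using t s powr_mono[of "s - 1" 0 "1 + t"] by simp
    ultimately show "\<exists>d. (h has_real_derivative d) (at t) \<and> 0 \<le> d"
      using s by (intro exI[of _ "s * (1 - (1 + t) powr (s - 1))"]) auto
  qed
  then show ?thesis by (simp add: h_def)
qed

text \<open>The difference of the sides has derivative \<open>r * (u + v - 2)\<close>. Here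
  \<open>u * v\<close> is a nonpositive power of \<open>1 - t^2\<close>, hence at least 1, and AM-GM
  gives that \<open>u + v\<close> is at least 2.\<close>

lemma powr_diff_ge:
  fixes r y :: real
  assumes r: "0 < r" "r < 1" and y: "0 \<le> y" "y < 1"
  shows "2 * r * y \<le> (1 + y) powr r - (1 - y) powr r"
proof -
  define h where "h = (\<lambda>t::real. (1 + t) powr r - (1 - t) powr r - 2 * r * t)"
  have "h 0 \<le> h y"
  proof (rule DERIV_nonneg_imp_nondecreasing[OF y(1)])
    fix t assume t: "0 \<le> t" "t \<le> y"
    define u v where "u = (1 + t) powr (r - 1)" and "v = (1 - t) powr (r - 1)"
    have deriv: "(h has_real_derivative (r * u + r * v - 2 * r)) (at t)"
      unfolding h_def u_def v_def using t y
      by (auto intro!: derivative_eq_intros simp: powr_diff)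
    have uv_eq: "u * v = (1 - t^2) powr (r - 1)"
      unfolding u_def v_def using t y
      by (subst powr_mult[symmetric]) (auto simp: power2_eq_square algebra_simps)
    have uv: "1 \<le> u * v"
    proof -
      have "t\<^sup>2 < 1" using t y by (simp add: abs_square_less_1)
      then show ?thesis using powr_mono2'[of "r - 1" "1 - t\<^sup>2" 1] r by (simp add: uv_eq)
    qed
    have pos: "0 < u" "0 < v" using t y unfolding u_def v_def by auto
    have "2 \<le> u + v"
    proof (rule ccontr)
      assume "\<not> ?thesis"
      then have "(u + v)^2 < 2^2" using pos by (intro power_strict_mono) auto
      moreover have "(u - v)^2 \<ge> 0" by simp
      ultimately show False using uv by (simp add: power2_eq_square algebra_simps)
    qed
    then have "0 \<le> r * (u + v - 2)" using r by simp
    then show "\<exists>d. (h has_real_derivative d) (at t) \<and> 0 \<le> d"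
      using deriv by (intro exI[of _ "r * u + r * v - 2 * r"]) (auto simp: algebra_simps)
  qed
  then show ?thesis by (simp add: h_def)
qed

text \<open>The derivative of the slack is \<open>1 + \<rho>\<close> times the slack in
  \<open>powr_diff_ge\<close>.\<close>

lemma powr_sum_ge:
  fixes \<rho> y :: real
  assumes \<rho>: "0 < \<rho>" "\<rho> < 1" and y: "0 \<le> y" "y \<le> 1"
  shows "2 + (1 + \<rho>) * \<rho> * y\<^sup>2 \<le> (1 + y) powr (1 + \<rho>) + (1 - y) powr (1 + \<rho>)"
proof -
  define h where "h = (\<lambda>t::real. (1 + t) powr (1 + \<rho>) + (1 - t) powr (1 + \<rho>) - (1 + \<rho>) * \<rho> * t\<^sup>2)"
  have "h 0 \<le> h y"
  \<comment> \<open>The open interval with continuity at its ends is needed because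
    \<open>y = 1\<close> is allowed, where \<open>1 - t\<close> reaches 0 and the differentiation
    rule for powers stops.\<close>
  proof (rule DERIV_nonneg_imp_increasing_open[OF y(1)])
    fix t assume t: "0 < t" "t < y"
    have "(h has_real_derivative (1 + \<rho>) * ((1 + t) powr \<rho> - (1 - t) powr \<rho> - 2 * \<rho> * t)) (at t)"
      unfolding h_def using t y
      by (auto intro!: derivative_eq_intros simp: algebra_simps)
    moreover have "0 \<le> (1 + \<rho>) * ((1 + t) powr \<rho> - (1 - t) powr \<rho> - 2 * \<rho> * t)"
      using powr_diff_ge[of \<rho> t] t y \<rho> by simp
    ultimately show "\<exists>d. (h has_real_derivative d) (at t) \<and> 0 \<le> d" by blast
  next
    show "continuous_on {0..y} h"
      unfolding h_def using y \<rho> by (intro continuous_on_diff continuous_on_add continuous_on_powr' continuous_intros) auto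
  qed
  then show ?thesis by (simp add: h_def)
qed

definition pmean :: "real \<Rightarrow> real \<Rightarrow> real \<Rightarrow> real" where
  "pmean p a b = ((a powr p + b powr p) / 2) powr (1 / p)"

text \<open>With \<open>p = 1 + \<rho>\<close>, Bernoulli for the exponent \<open>p / 2\<close>
  turns the left side into the quadratic of \<open>powr_sum_ge\<close>; the power
  \<open>2 / p\<close> undoes this.\<close>

lemma two_point_normalized:
  fixes \<rho> y :: real
  assumes \<rho>: "0 < \<rho>" "\<rho> < 1" and y: "0 \<le> y" "y \<le> 1"
  shows "1 + \<rho> * y\<^sup>2 \<le> (pmean (1 + \<rho>) (1 + y) (1 - y))\<^sup>2"
proof -
  define p where "p = 1 + \<rho>"
  have "(1 + \<rho> * y\<^sup>2) powr (p / 2) \<le> 1 + (p / 2) * (\<rho> * y\<^sup>2)"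
    using \<rho> by (intro powr_one_plus_le) (auto simp: p_def)
  also have "\<dots> \<le> ((1 + y) powr p + (1 - y) powr p) / 2"
    using powr_sum_ge[OF assms] by (simp add: p_def)
  finally have "((1 + \<rho> * y\<^sup>2) powr (p / 2)) powr (2 / p) \<le> (((1 + y) powr p + (1 - y) powr p) / 2) powr (2 / p)"
    using \<rho> by (intro powr_mono2) (auto simp: p_def)
  also have "((1 + \<rho> * y\<^sup>2) powr (p / 2)) powr (2 / p) = 1 + \<rho> * y\<^sup>2"
  proof -
    have "p / 2 * (2 / p) = 1" using \<rho> by (simp add: p_def)
    then show ?thesis using \<rho> by (simp add: powr_powr add_pos_nonneg del: times_divide_times_eq)
  qed
  also have "(((1 + y) powr p + (1 - y) powr p) / 2) powr (2 / p) = (pmean p (1 + y) (1 - y))\<^sup>2"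
    by (simp add: pmean_def powr_powr powr_realpow' power2_eq_square flip: powr_add)
  finally show ?thesis by (simp add: p_def)
qed

lemma pmean_scale:
  assumes "0 \<le> c" "0 \<le> a" "0 \<le> b" "p > 0"
  shows "pmean p (c * a) (c * b) = c * pmean p a b"
proof -
  have "((c * a) powr p + (c * b) powr p) / 2 = c powr p * ((a powr p + b powr p) / 2)"
    using assms by (simp add: powr_mult distrib_left)
  then show ?thesis unfolding pmean_def
    using assms by (simp only:, subst powr_mult) (auto simp: powr_powr)
qed

text \<open>Bonami's two-point inequality: the left side is the squared 2-norm of
  \<open>(a, b)\<close> after scaling its odd part by the square root of \<open>\<rho>\<close>.
  Symmetry and homogeneity reduce it to mean 1.\<close>

lemma two_point:
  fixes \<rho> a b :: real
  assumes \<rho>: "0 < \<rho>" "\<rho> < 1" and ab: "0 \<le> a" "0 \<le> b"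
  shows "((a + b) / 2)\<^sup>2 + \<rho> * ((a - b) / 2)\<^sup>2 \<le> (pmean (1 + \<rho>) a b)\<^sup>2"
proof -
  have *: "((a + b) / 2)\<^sup>2 + \<rho> * ((a - b) / 2)\<^sup>2 \<le> (pmean (1 + \<rho>) a b)\<^sup>2" if "0 \<le> b" "b \<le> a" for a b
  proof (cases "a + b = 0")
    case True
    then have "a = 0" "b = 0" using that by auto
    then show ?thesis by simp
  next
    case False
    define m y where "m = (a + b) / 2" and "y = (a - b) / (a + b)"
    have m: "m > 0" "0 \<le> y" "y \<le> 1" using that False by (auto simp: m_def y_def)
    have a: "a = m * (1 + y)" "b = m * (1 - y)" using False by (auto simp: m_def y_def field_simps)
    have "((a + b) / 2)\<^sup>2 + \<rho> * ((a - b) / 2)\<^sup>2 = m\<^sup>2 * (1 + \<rho> * y\<^sup>2)"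
      unfolding a by (simp add: field_simps power2_eq_square)
    also have "\<dots> \<le> m\<^sup>2 * (pmean (1 + \<rho>) (1 + y) (1 - y))\<^sup>2"
      using two_point_normalized[OF \<rho> m(2,3)] by (intro mult_left_mono) auto
    also have "\<dots> = (pmean (1 + \<rho>) a b)\<^sup>2"
      unfolding a using m \<rho> by (subst pmean_scale) (auto simp: power_mult_distrib)
    finally show ?thesis .
  qed
  show ?thesis
  proof (cases "b \<le> a")
    case True then show ?thesis using * ab by blast
  next
    case False
    then show ?thesis using *[of a b] ab
      by (simp add: pmean_def add.commute power2_commute[of a b] power_divide)
  qed
qed

text \<open>
  For \<open>\<rho> = 1 - 2 \<eta>\<close> the left-hand side is \<open>m n + \<rho> s t\<close> with \<open>m, n\<close> the means and \<open>s, t\<close> the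
  half-differences; Cauchy--Schwarz reduces it to the one-function inequality.
\<close>

lemma two_point_bilinear:
  fixes \<eta> a b c d :: real
  assumes \<eta>: "0 < \<eta>" "\<eta> < 1 / 2" and nn: "0 \<le> a" "0 \<le> b" "0 \<le> c" "0 \<le> d"
  shows "((1 - \<eta>) * (a * c + b * d) + \<eta> * (a * d + b * c)) / 2
    \<le> pmean (2 - 2 * \<eta>) a b * pmean (2 - 2 * \<eta>) c d"
proof -
  define \<rho> where "\<rho> = 1 - 2 * \<eta>"
  have \<rho>: "0 < \<rho>" "\<rho> < 1" and p: "2 - 2 * \<eta> = 1 + \<rho>" using \<eta> by (auto simp: \<rho>_def)
  define m n s t where "m = (a + b) / 2" and "n = (c + d) / 2" and "s = (a - b) / 2" and "t = (c - d) / 2"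
  have eq: "((1 - \<eta>) * (a * c + b * d) + \<eta> * (a * d + b * c)) / 2 = m * n + \<rho> * (s * t)"
    by (simp add: m_def n_def s_def t_def \<rho>_def field_simps)
  have "(m * n + \<rho> * (s * t))\<^sup>2 \<le> (m\<^sup>2 + \<rho> * s\<^sup>2) * (n\<^sup>2 + \<rho> * t\<^sup>2)"
  proof -
    have "(m\<^sup>2 + \<rho> * s\<^sup>2) * (n\<^sup>2 + \<rho> * t\<^sup>2) - (m * n + \<rho> * (s * t))\<^sup>2 = \<rho> * (m * t - n * s)\<^sup>2"
      by (simp add: power2_eq_square algebra_simps)
    moreover have "\<rho> * (m * t - n * s)\<^sup>2 \<ge> 0" using \<rho> by simp
    ultimately show ?thesis by linarith
  qed
  also have "\<dots> \<le> (pmean (1 + \<rho>) a b)\<^sup>2 * (pmean (1 + \<rho>) c d)\<^sup>2"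
    using two_point[OF \<rho> nn(1,2)] two_point[OF \<rho> nn(3,4)] \<rho>
    unfolding m_def n_def s_def t_def by (intro mult_mono) auto
  finally have "(m * n + \<rho> * (s * t))\<^sup>2 \<le> (pmean (1 + \<rho>) a b * pmean (1 + \<rho>) c d)\<^sup>2"
    by (simp add: power_mult_distrib)
  then show ?thesis unfolding eq p
    by (rule power2_le_imp_le) (simp add: pmean_def)
qed

section \<open>Noise on the cube\<close>

lemma sum_lessThan_double:
  fixes f :: "nat \<Rightarrow> 'a::comm_monoid_add"
  shows "(\<Sum>x<2 * m. f x) = (\<Sum>x<m. f (2 * x) + f (2 * x + 1))"
  by (induction m) (simp_all add: add.assoc)

lemma xor_double:
  fixes x z :: nat
  shows "(2 * x) XOR (2 * z) = 2 * (x XOR z)"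
    and "(2 * x) XOR (2 * z + 1) = 2 * (x XOR z) + 1"
    and "(2 * x + 1) XOR (2 * z) = 2 * (x XOR z) + 1"
    and "(2 * x + 1) XOR (2 * z + 1) = 2 * (x XOR z)"
  by (subst xor_rec; simp)+

text \<open>
  Points of \<open>{0,1}\<^sup>n\<close> are coded as natural numbers below \<open>2 ^ n\<close>, and inductions on \<open>n\<close> split off
  the lowest bit.
\<close>

definition noise :: "real \<Rightarrow> nat \<Rightarrow> nat \<Rightarrow> real" where
  "noise \<eta> n z = (\<Prod>a<n. if bit z a then \<eta> else 1 - \<eta>)"

lemma noise_0 [simp]: "noise \<eta> 0 z = 1"
  by (simp add: noise_def)

lemma noise_Suc:
  "noise \<eta> (Suc n) (2 * z) = (1 - \<eta>) * noise \<eta> n z"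
  "noise \<eta> (Suc n) (2 * z + 1) = \<eta> * noise \<eta> n z"
  unfolding noise_def by (simp_all add: prod.lessThan_Suc_shift bit_Suc bit_0 del: prod.lessThan_Suc)

lemma noise_pos:
  assumes "0 < \<eta>" "\<eta> < 1"
  shows "0 < noise \<eta> n z"
  unfolding noise_def using assms by (intro prod_pos) auto

text \<open>No factor exceeds \<open>1 - \<eta>\<close>. This bounds the mass of a single point,
  later of a character.\<close>

lemma noise_le:
  assumes "0 < \<eta>" "\<eta> \<le> 1 / 2"
  shows "noise \<eta> n z \<le> (1 - \<eta>) ^ n"
proof -
  have "noise \<eta> n z \<le> (\<Prod>a<n. 1 - \<eta>)"
    unfolding noise_def using assms by (intro prod_mono) auto
  then show ?thesis by simp
qed

lemma sum_noise: "(\<Sum>z<2 ^ n. noise \<eta> n z) = 1"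
proof (induction n)
  case (Suc n)
  have "(\<Sum>z<2 ^ Suc n. noise \<eta> (Suc n) z) = (\<Sum>z<2 ^ n. noise \<eta> n z)"
    unfolding power_Suc sum_lessThan_double noise_Suc by (intro sum.cong) (auto simp: algebra_simps)
  then show ?case using Suc by simp
qed simp

definition weight :: "nat \<Rightarrow> nat \<Rightarrow> nat" where
  "weight n z = card {a. a < n \<and> bit z a}"

lemma weight_conv_sum: "weight n z = (\<Sum>a<n. of_bool (bit z a))"
  unfolding weight_def by (simp add: lessThan_def Collect_conj_eq Int_commute)

lemma weight_Suc:
  "weight (Suc n) (2 * z) = weight n z"
  "weight (Suc n) (2 * z + 1) = Suc (weight n z)"
  unfolding weight_conv_sum
  by (simp_all add: sum.lessThan_Suc_shift bit_Suc bit_0 del: sum.lessThan_Suc sum_of_bool_eq)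

text \<open>Variance plus squared bias of a binomial variable. The centre \<open>c\<close> stays
  free because a lowest bit that is set shifts it to \<open>c - 1\<close> in the induction.\<close>

lemma noise_second_moment:
  "(\<Sum>z<2 ^ n. noise \<eta> n z * (real (weight n z) - c)\<^sup>2) = real n * \<eta> * (1 - \<eta>) + (\<eta> * real n - c)\<^sup>2"
proof (induction n arbitrary: c)
  case 0
  show ?case by (simp add: weight_def)
next
  case (Suc n)
  have "(\<Sum>z<2 ^ Suc n. noise \<eta> (Suc n) z * (real (weight (Suc n) z) - c)\<^sup>2)
    = (1 - \<eta>) * (\<Sum>z<2 ^ n. noise \<eta> n z * (real (weight n z) - c)\<^sup>2)
      + \<eta> * (\<Sum>z<2 ^ n. noise \<eta> n z * (real (weight n z) - (c - 1))\<^sup>2)"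
    unfolding power_Suc sum_lessThan_double noise_Suc weight_Suc sum_distrib_left sum.distrib
    by (intro arg_cong2[of _ _ _ _ "(+)"] sum.cong) (auto simp: algebra_simps)
  also have "\<dots> = real (Suc n) * \<eta> * (1 - \<eta>) + (\<eta> * real (Suc n) - c)\<^sup>2"
    unfolding Suc.IH by (simp add: power2_eq_square algebra_simps)
  finally show ?case .
qed

text \<open>Chebyshev: on the summation set the weight exceeds its mean \<open>\<eta> * n\<close> by
  at least that mean.\<close>

lemma noise_tail:
  assumes "0 < \<eta>" "\<eta> < 1" "0 < n"
  shows "(\<Sum>z | z < 2 ^ n \<and> 2 * \<eta> * real n < real (weight n z). noise \<eta> n z) \<le> (1 - \<eta>) / (\<eta> * real n)"
    (is "sum _ ?S \<le> _")
proof -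
  have "(\<eta> * real n)\<^sup>2 * sum (noise \<eta> n) ?S = (\<Sum>z\<in>?S. noise \<eta> n z * (\<eta> * real n)\<^sup>2)"
    by (simp add: sum_distrib_left mult.commute)
  also have "\<dots> \<le> (\<Sum>z\<in>?S. noise \<eta> n z * (real (weight n z) - \<eta> * real n)\<^sup>2)"
    using assms noise_pos[of \<eta> n] by (intro sum_mono mult_left_mono power_mono) (auto intro: less_imp_le)
  also have "\<dots> \<le> (\<Sum>z<2 ^ n. noise \<eta> n z * (real (weight n z) - \<eta> * real n)\<^sup>2)"
    using assms noise_pos[of \<eta> n] by (intro sum_mono2) (auto intro!: mult_nonneg_nonneg intro: less_imp_le)
  also have "\<dots> = real n * \<eta> * (1 - \<eta>)"
    by (simp add: noise_second_moment)
  finally have "\<eta> * real n * (\<eta> * real n * sum (noise \<eta> n) ?S) \<le> \<eta> * real n * (1 - \<eta>)"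
    by (simp add: power2_eq_square mult_ac)
  then have "\<eta> * real n * sum (noise \<eta> n) ?S \<le> 1 - \<eta>"
    using assms by (simp only: mult_le_cancel_left_pos[of "\<eta> * real n"] mult_pos_pos of_nat_0_less_iff)
  then show ?thesis
    using assms by (simp add: pos_le_divide_eq mult_ac)
qed

section \<open>Noisy correlation and hypercontractivity\<close>

definition noise_form :: "real \<Rightarrow> nat \<Rightarrow> (nat \<Rightarrow> real) \<Rightarrow> (nat \<Rightarrow> real) \<Rightarrow> real" where
  "noise_form \<eta> n f g = (\<Sum>x<2 ^ n. \<Sum>z<2 ^ n. noise \<eta> n z * (f x * g (x XOR z))) / 2 ^ n"

text \<open>The lowest noise bit decides whether a half of \<open>f\<close> meets the same half of
  \<open>g\<close> (probability \<open>1 - \<eta>\<close>) or the other one.\<close>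

lemma noise_form_Suc:
  fixes f g :: "nat \<Rightarrow> real"
  defines "f0 \<equiv> \<lambda>x. f (2 * x)" and "f1 \<equiv> \<lambda>x. f (2 * x + 1)"
    and "g0 \<equiv> \<lambda>x. g (2 * x)" and "g1 \<equiv> \<lambda>x. g (2 * x + 1)"
  shows "noise_form \<eta> (Suc n) f g =
    ((1 - \<eta>) * (noise_form \<eta> n f0 g0 + noise_form \<eta> n f1 g1)
      + \<eta> * (noise_form \<eta> n f0 g1 + noise_form \<eta> n f1 g0)) / 2"
proof -
  have "(\<Sum>x<2 ^ Suc n. \<Sum>z<2 ^ Suc n. noise \<eta> (Suc n) z * (f x * g (x XOR z))) =
    (\<Sum>x<2 ^ n. \<Sum>z<2 ^ n.
        (1 - \<eta>) * (noise \<eta> n z * (f0 x * g0 (x XOR z)))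
      + (1 - \<eta>) * (noise \<eta> n z * (f1 x * g1 (x XOR z)))
      + \<eta> * (noise \<eta> n z * (f0 x * g1 (x XOR z)))
      + \<eta> * (noise \<eta> n z * (f1 x * g0 (x XOR z))))"
    unfolding power_Suc sum_lessThan_double noise_Suc xor_double f0_def f1_def g0_def g1_def
      sum.distrib[symmetric]
    by (intro sum.cong) (simp_all add: algebra_simps)
  also have "\<dots> = 2 ^ n * ((1 - \<eta>) * (noise_form \<eta> n f0 g0 + noise_form \<eta> n f1 g1)
      + \<eta> * (noise_form \<eta> n f0 g1 + noise_form \<eta> n f1 g0))"
    unfolding noise_form_def sum.distrib sum_distrib_left[symmetric] by (simp add: field_simps)
  finally show ?thesis unfolding noise_form_def[of \<eta> "Suc n"] by simp
qed

definition cube_norm :: "real \<Rightarrow> nat \<Rightarrow> (nat \<Rightarrow> real) \<Rightarrow> real" where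
  "cube_norm p n f = ((\<Sum>x<2 ^ n. f x powr p) / 2 ^ n) powr (1 / p)"

lemma cube_norm_nonneg: "0 \<le> cube_norm p n f"
  by (simp add: cube_norm_def)

lemma cube_norm_Suc:
  assumes "0 < p"
  shows "cube_norm p (Suc n) f = pmean p (cube_norm p n (\<lambda>x. f (2 * x))) (cube_norm p n (\<lambda>x. f (2 * x + 1)))"
proof -
  have *: "cube_norm p n h powr p = (\<Sum>x<2 ^ n. h x powr p) / 2 ^ n" for h
  proof -
    have "0 \<le> (\<Sum>x<2 ^ n. h x powr p)" by (intro sum_nonneg) auto
    then show ?thesis using assms by (simp add: cube_norm_def powr_powr)
  qed
  have "(\<Sum>x<2 ^ Suc n. f x powr p) / 2 ^ Suc n
    = (cube_norm p n (\<lambda>x. f (2 * x)) powr p + cube_norm p n (\<lambda>x. f (2 * x + 1)) powr p) / 2"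
    unfolding * power_Suc sum_lessThan_double sum.distrib by (simp add: field_simps)
  then show ?thesis unfolding cube_norm_def[of p "Suc n"] pmean_def by (simp only:)
qed

text \<open>
  The two-function form of the Bonami--Beckner inequality tensorizes directly: fix the lowest bits,
  apply the induction hypothesis, then the two-point inequality to the resulting norms.
\<close>

lemma hypercontractivity:
  fixes f g :: "nat \<Rightarrow> real"
  assumes \<eta>: "0 < \<eta>" "\<eta> < 1 / 2" and "\<And>x. 0 \<le> f x" "\<And>x. 0 \<le> g x"
  shows "noise_form \<eta> n f g \<le> cube_norm (2 - 2 * \<eta>) n f * cube_norm (2 - 2 * \<eta>) n g"
  using assms(3,4)
proof (induction n arbitrary: f g)
  case 0
  then show ?case using \<eta> by (simp add: noise_form_def cube_norm_def powr_powr)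
next
  case (Suc n)
  let ?N = "cube_norm (2 - 2 * \<eta>) n"
  let ?f0 = "\<lambda>x. f (2 * x)" and ?f1 = "\<lambda>x. f (2 * x + 1)" and ?g0 = "\<lambda>x. g (2 * x)" and ?g1 = "\<lambda>x. g (2 * x + 1)"
  have "noise_form \<eta> (Suc n) f g \<le>
    ((1 - \<eta>) * (?N ?f0 * ?N ?g0 + ?N ?f1 * ?N ?g1) + \<eta> * (?N ?f0 * ?N ?g1 + ?N ?f1 * ?N ?g0)) / 2"
    unfolding noise_form_Suc
    using \<eta> Suc by (intro divide_right_mono add_mono mult_left_mono Suc.IH) auto
  also have "\<dots> \<le> pmean (2 - 2 * \<eta>) (?N ?f0) (?N ?f1) * pmean (2 - 2 * \<eta>) (?N ?g0) (?N ?g1)"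
    by (intro two_point_bilinear \<eta> cube_norm_nonneg)
  finally show ?case using \<eta> by (simp add: cube_norm_Suc)
qed

text \<open>Small-set expansion: the \<open>p\<close>-norm of an indicator is the density to the
  power \<open>1 / p\<close>, and with \<open>p = 2 - 2 * \<eta>\<close> two such factors multiply
  to the exponent \<open>1 / (1 - \<eta>)\<close>.\<close>

lemma noise_form_indicator_le:
  assumes \<eta>: "0 < \<eta>" "\<eta> < 1 / 2" and A: "A \<subseteq> {..<2 ^ n}"
  shows "noise_form \<eta> n (indicator A) (indicator A) \<le> (real (card A) / 2 ^ n) powr (1 / (1 - \<eta>))"
proof -
  let ?p = "2 - 2 * \<eta>"
  have "(\<Sum>x<2 ^ n. (indicator A x :: real) powr ?p) = (\<Sum>x<2 ^ n. indicator A x)"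
    using \<eta> by (intro sum.cong) (auto simp: indicator_def)
  also have "\<dots> = real (card A)"
    using A by (simp add: indicator_def of_bool_def[symmetric] Int_absorb1)
  finally have "cube_norm ?p n (indicator A) = (real (card A) / 2 ^ n) powr (1 / ?p)"
    by (simp add: cube_norm_def)
  moreover have "noise_form \<eta> n (indicator A) (indicator A) \<le> cube_norm ?p n (indicator A) * cube_norm ?p n (indicator A)"
    by (intro hypercontractivity \<eta>) auto
  moreover have "1 / ?p + 1 / ?p = 1 / (1 - \<eta>)" using \<eta> by (simp add: field_simps)
  ultimately show ?thesis by (simp flip: powr_add)
qed

section \<open>Characters and classes of Boolean functions\<close>

text \<open>The character (-1)^(S . a) of the group F_2^k, with \<open>S\<close> and
  \<open>a\<close> read as bit vectors.\<close>

definition walsh :: "nat \<Rightarrow> nat \<Rightarrow> nat \<Rightarrow> real" where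
  "walsh k S a = (\<Prod>b<k. if bit S b \<and> bit a b then - 1 else 1)"

lemma walsh_xor: "walsh k (S XOR T) a = walsh k S a * walsh k T a"
  unfolding walsh_def prod.distrib[symmetric] by (intro prod.cong) (auto simp: bit_xor_iff)

lemma walsh_cases: "walsh k S a = 1 \<or> walsh k S a = - 1"
  unfolding walsh_def by (induction k) auto

lemma walsh_0 [simp]: "walsh k 0 a = 1"
  by (simp add: walsh_def)

lemma walsh_Suc:
  "walsh (Suc k) S (2 * a) = walsh k (S div 2) a"
  "walsh (Suc k) S (2 * a + 1) = (if odd S then - 1 else 1) * walsh k (S div 2) a"
  unfolding walsh_def by (simp_all add: prod.lessThan_Suc_shift bit_Suc bit_0 del: prod.lessThan_Suc)

text \<open>The sum factors over coordinates: each contributes 1 + 1 or 1 - 1.\<close>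

lemma sum_walsh_prod: "(\<Sum>a<2 ^ k. walsh k S a) = (\<Prod>b<k. if bit S b then 0 else 2)"
proof (induction k arbitrary: S)
  case (Suc k)
  show ?case
    unfolding power_Suc sum_lessThan_double walsh_Suc prod.lessThan_Suc_shift
    by (simp add: bit_Suc bit_0 flip: Suc.IH sum_distrib_left mult_2)
qed (simp add: walsh_def)

lemma sum_walsh:
  assumes "S < 2 ^ k" "S \<noteq> 0"
  shows "(\<Sum>a<2 ^ k. walsh k S a) = 0"
proof -
  have "\<exists>b<k. bit S b"
  proof (rule ccontr)
    assume "\<not> ?thesis"
    then have "take_bit k S = 0" by (intro bit_eqI) (auto simp: bit_take_bit_iff)
    then show False using assms by (simp add: take_bit_nat_eq_self)
  qed
  then show ?thesis unfolding sum_walsh_prod by auto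
qed

definition bit_sign :: "nat \<Rightarrow> nat \<Rightarrow> real" where
  "bit_sign f a = (if bit f a then - 1 else 1)"

lemma bit_sign_xor: "bit_sign (f XOR g) a = bit_sign f a * bit_sign g a"
  by (simp add: bit_sign_def bit_xor_iff)

lemma bit_sign_cases: "bit_sign f a = 1 \<or> bit_sign f a = - 1"
  by (simp add: bit_sign_def)

lemma bit_sign_mult_self [simp]: "bit_sign f a * bit_sign f a = 1"
  by (simp add: bit_sign_def)

lemma xor_eq_0_iff_nat:
  fixes x y :: nat
  shows "x XOR y = 0 \<longleftrightarrow> x = y"
  by (metis xor.assoc xor.right_neutral xor_self_eq)

lemma xor_cancel_nat [simp]:
  fixes x y :: nat
  shows "x XOR (x XOR y) = y"
  by (simp flip: xor.assoc)

lemma xor_less_exp: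
  fixes x y :: nat
  assumes "x < 2 ^ n" "y < 2 ^ n"
  shows "x XOR y < 2 ^ n"
  using assms by (metis take_bit_nat_eq_self take_bit_xor take_bit_nat_less_exp)

lemma bij_betw_xor:
  fixes y :: nat
  assumes "y < 2 ^ n"
  shows "bij_betw (\<lambda>x. x XOR y) {..<2 ^ n} {..<2 ^ n}"
  by (rule bij_betwI[where g = "\<lambda>x. x XOR y"]) (auto simp: xor_less_exp assms xor.assoc)

text \<open>
  A function \<open>F\<^sub>2\<^sup>k \<rightarrow> {1, -1}\<close> is coded by the natural number whose bit \<open>a\<close> is set iff the value
  at \<open>a\<close> is \<open>-1\<close>.
\<close>

definition character :: "nat \<Rightarrow> nat \<Rightarrow> nat" where
  "character k S = horner_sum of_bool 2 (map (\<lambda>a. walsh k S a < 0) [0..<2 ^ k])"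

lemma bit_character: "bit (character k S) a \<longleftrightarrow> a < 2 ^ k \<and> walsh k S a < 0"
  unfolding character_def by (auto simp: bit_horner_sum_bit_iff)

lemma character_less: "character k S < 2 ^ 2 ^ k"
proof -
  have "take_bit (2 ^ k) (character k S) = character k S"
    by (rule bit_eqI) (auto simp: bit_take_bit_iff bit_character)
  then show ?thesis by (simp add: take_bit_nat_eq_self_iff)
qed

lemma bit_sign_character: "a < 2 ^ k \<Longrightarrow> bit_sign (character k S) a = walsh k S a"
  using walsh_cases[of k S a] by (auto simp: bit_sign_def bit_character)

lemma character_xor: "character k (S XOR T) = character k S XOR character k T"
proof (rule bit_eqI)
  fix a
  show "bit (character k (S XOR T)) a = bit (character k S XOR character k T) a"
    using walsh_cases[of k S a] walsh_cases[of k T a]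
    by (auto simp: bit_xor_iff bit_character walsh_xor)
qed

text \<open>Equal characters would make the one of \<open>S XOR T\<close> constantly 1, but a
  nontrivial character sums to 0.\<close>

lemma character_inj:
  assumes "S < 2 ^ k" "T < 2 ^ k" "character k S = character k T"
  shows "S = T"
proof -
  have "(\<Sum>a<2 ^ k. walsh k (S XOR T) a) = (\<Sum>a<(2::nat) ^ k. 1)"
    by (intro sum.cong refl, unfold walsh_xor) (simp add: bit_sign_character[symmetric] assms(3))
  then have "S XOR T = 0"
    using sum_walsh[of "S XOR T" k] xor_less_exp[OF assms(1,2)] by auto
  then show ?thesis by (simp add: xor_eq_0_iff_nat)
qed

section \<open>The vectors of a Boolean function\<close>

definition cube_vec :: "nat \<Rightarrow> nat \<Rightarrow> real vec" where
  "cube_vec N f = vec N (\<lambda>a. bit_sign f a / sqrt (real N))"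

lemma cube_vec_carrier [simp]: "cube_vec N f \<in> carrier_vec N"
  by (simp add: cube_vec_def)

lemma cube_vec_inner: "cube_vec N f \<bullet> cube_vec N g = (\<Sum>a<N. bit_sign f a * bit_sign g a) / real N"
  by (simp add: cube_vec_def scalar_prod_def sum_divide_distrib lessThan_atLeast0)

lemma cube_vec_inner_xor: "cube_vec N (f XOR h) \<bullet> cube_vec N (g XOR h) = cube_vec N f \<bullet> cube_vec N g"
proof -
  have "bit_sign (f XOR h) a * bit_sign (g XOR h) a = bit_sign f a * bit_sign g a" for a
    by (simp add: bit_sign_def bit_xor_iff)
  then show ?thesis by (simp add: cube_vec_inner)
qed

text \<open>Each differing coordinate changes a summand from 1 to -1. Noise of weight at most
  \<open>2 * \<eta> * N\<close> thus costs at most \<open>4 * \<eta>\<close>.\<close>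

lemma cube_vec_inner_weight:
  assumes "0 < N"
  shows "cube_vec N f \<bullet> cube_vec N g = 1 - 2 * real (weight N (f XOR g)) / real N"
proof -
  have "(\<Sum>a<N. bit_sign f a * bit_sign g a) = (\<Sum>a<N. 1 - 2 * of_bool (bit (f XOR g) a))"
    by (intro sum.cong) (auto simp: bit_sign_def bit_xor_iff)
  also have "\<dots> = real N - 2 * real (weight N (f XOR g))"
    by (simp add: sum_subtractf weight_conv_sum sum_distrib_left del: sum_of_bool_eq)
  finally show ?thesis using assms by (simp add: cube_vec_inner diff_divide_distrib)
qed

text \<open>Already true in each coordinate, for signs: if those of \<open>f\<close> and
  \<open>g\<close> differ both sides are 0, otherwise the right side is 2.\<close>

lemma cube_vec_triangle:
  assumes "0 < N"
  shows "cube_vec N f \<bullet> cube_vec N h + cube_vec N g \<bullet> cube_vec N h \<le> 1 + cube_vec N f \<bullet> cube_vec N g"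
proof -
  have "(\<Sum>a<N. bit_sign f a * bit_sign h a + bit_sign g a * bit_sign h a) \<le> (\<Sum>a<N. 1 + bit_sign f a * bit_sign g a)"
    by (intro sum_mono) (auto simp: bit_sign_def)
  then have "((\<Sum>a<N. bit_sign f a * bit_sign h a) + (\<Sum>a<N. bit_sign g a * bit_sign h a)) / real N
    \<le> (real N + (\<Sum>a<N. bit_sign f a * bit_sign g a)) / real N"
    by (intro divide_right_mono) (simp_all add: sum.distrib)
  then show ?thesis using assms by (simp add: cube_vec_inner add_divide_distrib)
qed

text \<open>The common factor \<open>f\<close> squares to 1, which leaves the sum of the character
  of \<open>i XOR j\<close>.\<close>

lemma cube_vec_orthonormal:
  assumes "i < 2 ^ k" "j < 2 ^ k"
  shows "cube_vec (2 ^ k) (f XOR character k i) \<bullet> cube_vec (2 ^ k) (f XOR character k j) = (if i = j then 1 else 0)"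
proof -
  have "(\<Sum>a<2 ^ k. bit_sign (f XOR character k i) a * bit_sign (f XOR character k j) a) = (\<Sum>a<2 ^ k. walsh k (i XOR j) a)"
  proof (intro sum.cong refl)
    fix a :: nat assume "a \<in> {..<2 ^ k}"
    then show "bit_sign (f XOR character k i) a * bit_sign (f XOR character k j) a = walsh k (i XOR j) a"
      using bit_sign_cases[of f a] by (auto simp: bit_sign_xor walsh_xor bit_sign_character)
  qed
  moreover have "i XOR j \<noteq> 0" if "i \<noteq> j" using that by (simp add: xor_eq_0_iff_nat)
  ultimately show ?thesis
    using sum_walsh[of "i XOR j" k] xor_less_exp[OF assms] by (auto simp: cube_vec_inner)
qed

text \<open>The matrix \<open>A\<close> with these rows satisfies
  \<open>A * transpose_mat A = 1\<^sub>m N\<close>, so its determinant is nonzero and its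
  \<open>N\<close> rows are independent in dimension \<open>N\<close>.\<close>

lemma orthonormal_basisI:
  assumes carr: "\<And>i. i < N \<Longrightarrow> b i \<in> carrier_vec N"
    and on: "\<And>i j. i < N \<Longrightarrow> j < N \<Longrightarrow> b i \<bullet> b j = (if i = j then 1 else 0)"
  shows "orthonormal_basis N b"
proof -
  interpret vec_space "TYPE(real)" N .
  define A where "A = mat_of_rows N (map b [0..<N])"
  have A: "A \<in> carrier_mat N N" 
    using mat_of_rows_carrier(1)[of N "map b [0..<N]"] by (simp add: A_def)
  have rows: "rows A = map b [0..<N]"
    unfolding A_def using carr by (intro rows_mat_of_rows) auto
  have "A * transpose_mat A = 1\<^sub>m N"
    using A on rows by (intro eq_matI) (auto simp: A_def carr)
  then have "det A * det A = 1"
    using A by (metis det_mult det_one det_transpose transpose_carrier_mat)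
  then have "det A \<noteq> 0" by auto
  then have "lin_indpt (set (rows A))" by (rule det_not_0_imp_lin_indpt_rows[OF A])
  moreover have rows_set: "set (rows A) = b ` {..<N}" by (simp add: rows lessThan_atLeast0)
  moreover have "inj_on b {..<N}"
    by (rule inj_onI) (metis on lessThan_iff zero_neq_one)
  then have "card (b ` {..<N}) = N" by (simp add: card_image)
  ultimately have "basis (b ` {..<N})"
    using carr by (intro dim_li_is_basis) (auto simp: dim_is_n)
  then show ?thesis unfolding orthonormal_basis_def using on by simp
qed

section \<open>Cosets of the group of characters\<close>

definition class_rep :: "nat \<Rightarrow> nat \<Rightarrow> nat" where
  "class_rep k f = Min ((\<lambda>S. f XOR character k S) ` {..<2 ^ k})"

definition class_idx :: "nat \<Rightarrow> nat \<Rightarrow> nat" where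
  "class_idx k f = (SOME S. S < 2 ^ k \<and> f = class_rep k f XOR character k S)"

text \<open>Multiplying by a character permutes the coset, so the minimum is taken over the same
  set.\<close>

lemma class_rep_xor:
  assumes "S < 2 ^ k"
  shows "class_rep k (f XOR character k S) = class_rep k f"
proof -
  have "(\<lambda>T. (f XOR character k S) XOR character k T) ` {..<2 ^ k}
      = (\<lambda>T. f XOR character k T) ` (\<lambda>T. T XOR S) ` {..<2 ^ k}"
    unfolding image_image character_xor by (simp add: xor.assoc xor.commute xor.left_commute)
  also have "(\<lambda>T. T XOR S) ` {..<2 ^ k} = {..<2 ^ k}"
    using bij_betw_xor[OF assms] by (simp add: bij_betw_def)
  finally show ?thesis by (simp add: class_rep_def)
qed

lemma class_idx:
  shows class_idx_less: "class_idx k f < 2 ^ k"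
    and class_rep_idx: "class_rep k f XOR character k (class_idx k f) = f"
proof -
  have "class_rep k f \<in> (\<lambda>S. f XOR character k S) ` {..<2 ^ k}"
    unfolding class_rep_def by (rule Min_in) (auto simp: lessThan_empty_iff)
  then obtain S where "S < 2 ^ k" "class_rep k f = f XOR character k S" by auto
  then have "S < 2 ^ k \<and> f = class_rep k f XOR character k S" by (simp add: xor.assoc)
  then have "class_idx k f < 2 ^ k \<and> f = class_rep k f XOR character k (class_idx k f)"
    unfolding class_idx_def by (rule someI)
  then show "class_idx k f < 2 ^ k" "class_rep k f XOR character k (class_idx k f) = f" by simp_all
qed

lemma class_idx_eqI:
  assumes "S < 2 ^ k" "f = class_rep k f XOR character k S"
  shows "class_idx k f = S"
proof -
  have "class_rep k f XOR (class_rep k f XOR character k (class_idx k f)) = class_rep k f XOR (class_rep k f XOR character k S)"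
    using assms(2) by (simp add: class_rep_idx)
  then have "character k (class_idx k f) = character k S" by (simp flip: xor.assoc)
  then show ?thesis using character_inj class_idx_less assms(1) by blast
qed

lemma class_idx_xor:
  assumes "S < 2 ^ k"
  shows "class_idx k (f XOR character k S) = class_idx k f XOR S"
  using assms by (intro class_idx_eqI)
    (simp_all add: xor_less_exp class_idx_less class_rep_xor character_xor class_rep_idx flip: xor.assoc)

lemma class_rep_conv: "class_rep k f = f XOR character k (class_idx k f)"
  by (metis class_rep_idx xor.assoc xor_self_eq xor.right_neutral)

lemma class_rep_class_rep [simp]: "class_rep k (class_rep k f) = class_rep k f"
  by (metis class_rep_conv class_rep_xor class_idx_less)

lemma class_idx_class_rep [simp]: "class_idx k (class_rep k f) = 0"
  by (metis class_rep_conv class_idx_xor class_idx_less xor_self_eq)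

lemma class_rep_less: "f < 2 ^ 2 ^ k \<Longrightarrow> class_rep k f < 2 ^ 2 ^ k"
  by (subst class_rep_conv) (simp add: xor_less_exp character_less)

text \<open>Noise that keeps a function within its class must be a character; this is what excludes
  loops.\<close>

lemma class_rep_eqD:
  assumes "class_rep k f = class_rep k g"
  shows "\<exists>S<2 ^ k. f XOR g = character k S"
proof -
  have "f XOR g = (class_rep k f XOR character k (class_idx k f)) XOR (class_rep k f XOR character k (class_idx k g))"
    using class_rep_idx[of k f] class_rep_idx[of k g] assms by simp
  also have "\<dots> = character k (class_idx k f XOR class_idx k g)"
    by (simp add: character_xor xor.assoc xor.left_commute)
  finally show ?thesis using xor_less_exp[OF class_idx_less class_idx_less] by blast
qed

text \<open>Each function is uniquely a representative times a character; counting gives the number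
  of vertices.\<close>

lemma bij_betw_class:
  "bij_betw (\<lambda>(v, S). v XOR character k S) (class_rep k ` {..<2 ^ 2 ^ k} \<times> {..<2 ^ k}) {..<2 ^ 2 ^ k}"
  by (rule bij_betwI[where g = "\<lambda>f. (class_rep k f, class_idx k f)"])
    (auto simp: xor_less_exp class_rep_less character_less class_idx_less class_rep_idx
      class_rep_xor class_idx_xor)

lemma card_class_reps: "card (class_rep k ` {..<2 ^ 2 ^ k}) * 2 ^ k = 2 ^ 2 ^ k"
  using bij_betw_same_card[OF bij_betw_class] by (simp add: card_cartesian_product)

section \<open>The integrality gap instance\<close>

text \<open>The weight bound serves the inner products along edges, the exclusion of characters
  (among them 0, the trivial one) serves looplessness.\<close>

definition good_noise :: "real \<Rightarrow> nat \<Rightarrow> nat set" where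
  "good_noise \<eta> k = {z. z < 2 ^ 2 ^ k \<and> real (weight (2 ^ k) z) \<le> 2 * \<eta> * 2 ^ k \<and> z \<notin> character k ` {..<2 ^ k}}"

definition good_mass :: "real \<Rightarrow> nat \<Rightarrow> real" where
  "good_mass \<eta> k = (\<Sum>z\<in>good_noise \<eta> k. noise \<eta> (2 ^ k) z)"

text \<open>An arc is the code of a pair \<open>(f, z)\<close> of a function and a noise vector.\<close>

definition gap_graph :: "real \<Rightarrow> nat \<Rightarrow> (nat, nat) pre_digraph" where
  "gap_graph \<eta> k = \<lparr>
     verts = class_rep k ` {..<2 ^ 2 ^ k},
     arcs = prod_encode ` ({..<2 ^ 2 ^ k} \<times> good_noise \<eta> k),
     tail = \<lambda>e. class_rep k (fst (prod_decode e)),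
     head = \<lambda>e. class_rep k (fst (prod_decode e) XOR snd (prod_decode e))\<rparr>"

text \<open>Label \<open>S\<close> at a vertex stands for its member with index \<open>S\<close>.
  The translation sends the index of \<open>f XOR z\<close> to that of \<open>f\<close> and commutes
  with multiplying both by a character.\<close>

definition gap_perm :: "nat \<Rightarrow> nat \<Rightarrow> nat \<Rightarrow> nat" where
  "gap_perm k e j = (case prod_decode e of (f, z) \<Rightarrow> j XOR (class_idx k f XOR class_idx k (f XOR z)))"

definition gap_wt :: "real \<Rightarrow> nat \<Rightarrow> nat \<Rightarrow> real" where
  "gap_wt \<eta> k e = noise \<eta> (2 ^ k) (snd (prod_decode e)) / (2 ^ 2 ^ k * good_mass \<eta> k)"

definition gap_vec :: "nat \<Rightarrow> nat \<Rightarrow> nat \<Rightarrow> real vec" where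
  "gap_vec k v i = cube_vec (2 ^ k) (v XOR character k i)"

lemma finite_good_noise [simp]: "finite (good_noise \<eta> k)"
  unfolding good_noise_def by simp

lemma good_noise_less: "z \<in> good_noise \<eta> k \<Longrightarrow> z < 2 ^ 2 ^ k"
  by (simp add: good_noise_def)

lemma sum_gap_arcs:
  "(\<Sum>e\<in>arcs (gap_graph \<eta> k). F (prod_decode e)) = (\<Sum>f<2 ^ 2 ^ k. \<Sum>z\<in>good_noise \<eta> k. F (f, z))"
  unfolding gap_graph_def by (simp add: sum.reindex[OF inj_prod_encode] sum.cartesian_product)

text \<open>Union bound: excluded noise is either too heavy (Chebyshev) or one of at most
  \<open>2 ^ k\<close> characters, and each kind has mass at most 1/4.\<close>

lemma good_mass_ge:
  assumes \<eta>: "0 < \<eta>" "\<eta> < 1 / 2"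
    and tail: "(1 - \<eta>) / (\<eta> * 2 ^ k) \<le> 1 / 4" and char: "2 ^ k * (1 - \<eta>) ^ (2 ^ k) \<le> 1 / 4"
  shows "1 / 2 \<le> good_mass \<eta> k"
proof -
  let ?N = "2 ^ k :: nat"
  let ?T = "{z. z < 2 ^ ?N \<and> 2 * \<eta> * real ?N < real (weight ?N z)}"
  let ?C = "character k ` {..<2 ^ k}"
  have nn: "0 \<le> noise \<eta> ?N z" for z using noise_pos[of \<eta> ?N z] \<eta> by simp
  have "1 = sum (noise \<eta> ?N) {..<2 ^ ?N}" by (simp add: sum_noise)
  also have "\<dots> \<le> sum (noise \<eta> ?N) (good_noise \<eta> k \<union> (?T \<union> ?C))"
    by (intro sum_mono2 nn) (auto simp: good_noise_def)
  also have "\<dots> \<le> good_mass \<eta> k + (sum (noise \<eta> ?N) ?T + sum (noise \<eta> ?N) ?C)"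
  proof -
    have *: "sum (noise \<eta> ?N) (A \<union> B) \<le> sum (noise \<eta> ?N) A + sum (noise \<eta> ?N) B" if "finite A" "finite B" for A B
      using sum_nonneg[of "A \<inter> B" "noise \<eta> ?N"] nn by (simp add: sum_Un that)
    show ?thesis
      unfolding good_mass_def by (intro order.trans[OF *] add_left_mono *) auto
  qed
  also have "sum (noise \<eta> ?N) ?T \<le> 1 / 4"
    using \<eta> tail by (intro order.trans[OF noise_tail]) auto
  also have "sum (noise \<eta> ?N) ?C \<le> real (card ?C) * (1 - \<eta>) ^ ?N"
    using \<eta> by (intro sum_bounded_above noise_le) auto
  also have "\<dots> \<le> 2 ^ k * (1 - \<eta>) ^ ?N"
  proof (rule mult_right_mono)
    have "card ?C \<le> 2 ^ k" using card_image_le[of "{..<2 ^ k}" "character k"] by simp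
    then have "real (card ?C) \<le> real (2 ^ k)" by (simp only: of_nat_le_iff)
    then show "real (card ?C) \<le> 2 ^ k" by simp
  qed (use \<eta> in auto)
  also have "\<dots> \<le> 1 / 4" by (rule char)
  finally show ?thesis by simp
qed

text \<open>If \<open>x\<close> is uniform, so is \<open>x XOR c\<close>. With \<open>c\<close> a
  character, all \<open>N\<close> terms in the bound on the satisfied weight become equal.\<close>

lemma noise_form_translate:
  assumes "c < 2 ^ n"
  shows "noise_form \<eta> n (\<lambda>x. f (x XOR c)) (\<lambda>x. g (x XOR c)) = noise_form \<eta> n f g"
proof -
  have "(\<Sum>x<2 ^ n. \<Sum>z<2 ^ n. noise \<eta> n z * (f (x XOR c) * g ((x XOR z) XOR c)))
    = (\<Sum>x<2 ^ n. \<Sum>z<2 ^ n. noise \<eta> n z * (f (x XOR c) * g ((x XOR c) XOR z)))"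
    by (simp add: xor.assoc xor.commute xor.left_commute)
  also have "\<dots> = (\<Sum>x<2 ^ n. \<Sum>z<2 ^ n. noise \<eta> n z * (f x * g (x XOR z)))"
    by (rule sum.reindex_bij_betw[OF bij_betw_xor[OF assms]])
  finally show ?thesis by (simp add: noise_form_def)
qed

lemma unique_games_gap:
  assumes \<eta>: "0 < \<eta>" "\<eta> < 1 / 2" and M: "0 < good_mass \<eta> k"
  shows "unique_games (gap_graph \<eta> k) (2 ^ k) (gap_perm k) (gap_wt \<eta> k)"
proof
  fix e assume "e \<in> arcs (gap_graph \<eta> k)"
  then obtain f z where e: "e = prod_encode (f, z)" and f: "f < 2 ^ 2 ^ k" and z: "z \<in> good_noise \<eta> k"
    by (auto simp: gap_graph_def)
  show "tail (gap_graph \<eta> k) e \<in> verts (gap_graph \<eta> k)" using f by (simp add: gap_graph_def e)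
  show "head (gap_graph \<eta> k) e \<in> verts (gap_graph \<eta> k)"
    using f good_noise_less[OF z] by (simp add: gap_graph_def e xor_less_exp)
  \<comment> \<open>A loop would make \<open>f XOR (f XOR z)\<close>, which is \<open>z\<close>, a
    character.\<close>
  show "tail (gap_graph \<eta> k) e \<noteq> head (gap_graph \<eta> k) e"
  proof
    assume "tail (gap_graph \<eta> k) e = head (gap_graph \<eta> k) e"
    then have "\<exists>S<2 ^ k. f XOR (f XOR z) = character k S"
      by (intro class_rep_eqD) (simp add: gap_graph_def e)
    then show False using z by (auto simp: good_noise_def)
  qed
  show "bij_betw (gap_perm k e) {..<2 ^ k} {..<2 ^ k}"
    unfolding gap_perm_def e by (simp add: bij_betw_xor xor_less_exp class_idx_less)
  show "0 < gap_wt \<eta> k e"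
    using noise_pos[of \<eta>] \<eta> M by (simp add: gap_wt_def)
next
  show "finite (verts (gap_graph \<eta> k))" "finite (arcs (gap_graph \<eta> k))"
    by (auto simp: gap_graph_def)
  have "(\<Sum>e\<in>arcs (gap_graph \<eta> k). gap_wt \<eta> k e)
    = (\<Sum>f<(2::nat) ^ 2 ^ k. \<Sum>z\<in>good_noise \<eta> k. noise \<eta> (2 ^ k) z / (2 ^ 2 ^ k * good_mass \<eta> k))"
    unfolding gap_wt_def using sum_gap_arcs[of "\<lambda>(f, z). noise \<eta> (2 ^ k) z / (2 ^ 2 ^ k * good_mass \<eta> k)"]
    by (simp add: case_prod_unfold)
  also have "\<dots> = 1"
    using M by (simp add: good_mass_def flip: sum_divide_distrib)
  finally show "(\<Sum>e\<in>arcs (gap_graph \<eta> k). gap_wt \<eta> k e) = 1" .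
qed

text \<open>The edge of \<open>(f, z)\<close> is satisfied only if a single character moves both
  \<open>f\<close> and \<open>f XOR z\<close> into the set \<open>A\<close> of selected functions.
  Summing over characters gives \<open>N\<close> copies of the noise form of \<open>A\<close>; the
  division by \<open>good_mass\<close> comes from the conditioning.\<close>

lemma satisfied_weight_le:
  assumes \<eta>: "0 < \<eta>" "\<eta> < 1 / 2" and M: "0 < good_mass \<eta> k"
    and lab: "lab \<in> verts (gap_graph \<eta> k) \<rightarrow> {..<2 ^ k}"
  shows "(\<Sum>e\<in>satisfied_edges (gap_graph \<eta> k) (gap_perm k) lab. gap_wt \<eta> k e)
    \<le> 2 ^ k * (1 / 2 ^ k) powr (1 / (1 - \<eta>)) / good_mass \<eta> k"
proof -
  let ?N = "2 ^ k :: nat"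
  let ?M = "good_mass \<eta> k"
  define A where "A = {f. f < 2 ^ ?N \<and> class_idx k f = lab (class_rep k f)}"
  have lab_less: "lab (class_rep k f) < 2 ^ k" if "f < 2 ^ ?N" for f
    using lab that by (auto simp: gap_graph_def)
  have A_eq: "class_rep k f XOR character k (lab (class_rep k f)) = f" if "f \<in> A" for f
    using that class_rep_idx[of k f] by (simp add: A_def)
  \<comment> \<open>The labeling selects exactly one member per class, so \<open>A\<close> has
    density \<open>1 / N\<close>.\<close>
  have "bij_betw (class_rep k) A (class_rep k ` {..<2 ^ ?N})"
    by (rule bij_betwI[where g = "\<lambda>v. v XOR character k (lab v)"])
      (auto simp: A_eq, auto simp: A_def xor_less_exp character_less class_rep_less class_rep_xor
        class_idx_xor lab_less)
  then have "card A * ?N = 2 ^ ?N"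
    using card_class_reps[of k] by (simp add: bij_betw_same_card)
  then have "real (card A * ?N) = real (2 ^ ?N)" by (rule arg_cong)
  then have card_A: "real (card A) / 2 ^ ?N = 1 / 2 ^ k"
    by (simp add: field_simps)
  define sat where "sat f z \<longleftrightarrow> lab (class_rep k f) =
      lab (class_rep k (f XOR z)) XOR (class_idx k f XOR class_idx k (f XOR z))" for f z
  let ?I = "\<lambda>S x. indicator A (x XOR character k S) :: real"
  have sat: "of_bool (sat f z) \<le> (\<Sum>S<?N. ?I S f * ?I S (f XOR z))" if "f < 2 ^ ?N" "z < 2 ^ ?N" for f z
  proof (cases "sat f z")
    case True
    \<comment> \<open>The character that carries \<open>f\<close> to the selected member of its
      class; satisfaction says that it does the same for \<open>f XOR z\<close>.\<close>
    let ?S = "class_idx k f XOR lab (class_rep k f)"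
    have S: "?S < ?N" using lab_less[OF that(1)] by (simp add: xor_less_exp class_idx_less)
    have S2: "?S = class_idx k (f XOR z) XOR lab (class_rep k (f XOR z))"
      using True unfolding sat_def by (simp add: xor.commute xor.left_commute)
    have *: "x XOR character k ?S \<in> A" if "x < 2 ^ ?N" "?S = class_idx k x XOR lab (class_rep k x)" for x
    proof -
      have "class_idx k (x XOR character k ?S) = lab (class_rep k x)"
        unfolding class_idx_xor[OF S] by (simp add: that(2))
      then show ?thesis using that(1) S
        by (simp add: A_def class_rep_xor xor_less_exp character_less)
    qed
    have "1 = ?I ?S f * ?I ?S (f XOR z)"
      using *[OF that(1) refl] *[OF _ S2] that by (simp add: xor_less_exp)
    also have "\<dots> \<le> (\<Sum>S<?N. ?I S f * ?I S (f XOR z))"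
      using S by (intro member_le_sum) auto
    finally show ?thesis using True by simp
  qed (auto intro!: sum_nonneg)
  have nn: "0 \<le> noise \<eta> ?N z" for z using noise_pos[of \<eta> ?N z] \<eta> by simp
  have "(\<Sum>e\<in>satisfied_edges (gap_graph \<eta> k) (gap_perm k) lab. gap_wt \<eta> k e)
    = (\<Sum>e\<in>arcs (gap_graph \<eta> k). (\<lambda>(f, z). of_bool (sat f z) * noise \<eta> ?N z / (2 ^ ?N * ?M)) (prod_decode e))"
  proof -
    have "(\<Sum>e\<in>satisfied_edges (gap_graph \<eta> k) (gap_perm k) lab. gap_wt \<eta> k e)
      = (\<Sum>e\<in>arcs (gap_graph \<eta> k). if lab (tail (gap_graph \<eta> k) e) = gap_perm k e (lab (head (gap_graph \<eta> k) e))
          then gap_wt \<eta> k e else 0)"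
      unfolding satisfied_edges_def by (intro sum.inter_filter) (simp add: gap_graph_def)
    also have "\<dots> = (\<Sum>e\<in>arcs (gap_graph \<eta> k). (\<lambda>(f, z). of_bool (sat f z) * noise \<eta> ?N z / (2 ^ ?N * ?M)) (prod_decode e))"
      by (intro sum.cong refl) (simp add: gap_graph_def gap_wt_def gap_perm_def sat_def case_prod_unfold)
    finally show ?thesis .
  qed
  also have "\<dots> = (\<Sum>f<2 ^ ?N. \<Sum>z\<in>good_noise \<eta> k. of_bool (sat f z) * noise \<eta> ?N z / (2 ^ ?N * ?M))"
    by (subst sum_gap_arcs) (simp only: prod.case)
  also have "\<dots> = (\<Sum>f<2 ^ ?N. \<Sum>z\<in>good_noise \<eta> k. of_bool (sat f z) * noise \<eta> ?N z) / (2 ^ ?N * ?M)"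
    by (simp only: sum_divide_distrib)
  also have "\<dots> \<le> (\<Sum>f<2 ^ ?N. \<Sum>z<2 ^ ?N. \<Sum>S<?N. noise \<eta> ?N z * (?I S f * ?I S (f XOR z))) / (2 ^ ?N * ?M)"
  proof (intro divide_right_mono sum_mono)
    fix f :: nat assume f: "f \<in> {..<2 ^ ?N}"
    \<comment> \<open>Dropping the conditioning on good noise only adds nonnegative terms.\<close>
    have "(\<Sum>z\<in>good_noise \<eta> k. of_bool (sat f z) * noise \<eta> ?N z) \<le> (\<Sum>z<2 ^ ?N. of_bool (sat f z) * noise \<eta> ?N z)"
      using nn by (intro sum_mono2) (auto simp: good_noise_less)
    also have "\<dots> \<le> (\<Sum>z<2 ^ ?N. noise \<eta> ?N z * (\<Sum>S<?N. ?I S f * ?I S (f XOR z)))"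
    proof (rule sum_mono)
      fix z :: nat assume "z \<in> {..<2 ^ ?N}"
      then show "of_bool (sat f z) * noise \<eta> ?N z \<le> noise \<eta> ?N z * (\<Sum>S<?N. ?I S f * ?I S (f XOR z))"
        using mult_left_mono[OF sat nn] f by (simp only: mult.commute[of "of_bool _"] lessThan_iff)
    qed
    finally show "(\<Sum>z\<in>good_noise \<eta> k. of_bool (sat f z) * noise \<eta> ?N z)
      \<le> (\<Sum>z<2 ^ ?N. \<Sum>S<?N. noise \<eta> ?N z * (?I S f * ?I S (f XOR z)))"
      by (simp add: sum_distrib_left)
  qed (use M in auto)
  also have "(\<Sum>f<2 ^ ?N. \<Sum>z<2 ^ ?N. \<Sum>S<?N. noise \<eta> ?N z * (?I S f * ?I S (f XOR z)))
      = (\<Sum>f<2 ^ ?N. \<Sum>S<?N. \<Sum>z<2 ^ ?N. noise \<eta> ?N z * (?I S f * ?I S (f XOR z)))"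
    by (rule sum.cong[OF refl], rule sum.swap)
  also have "\<dots> = (\<Sum>S<?N. \<Sum>f<2 ^ ?N. \<Sum>z<2 ^ ?N. noise \<eta> ?N z * (?I S f * ?I S (f XOR z)))"
    by (rule sum.swap)
  also have "\<dots> = (\<Sum>S<?N. 2 ^ ?N * noise_form \<eta> ?N (indicator A) (indicator A))"
  proof (rule sum.cong[OF refl])
    fix S
    show "(\<Sum>f<2 ^ ?N. \<Sum>z<2 ^ ?N. noise \<eta> ?N z * (?I S f * ?I S (f XOR z)))
      = 2 ^ ?N * noise_form \<eta> ?N (indicator A) (indicator A)"
      unfolding noise_form_translate[OF character_less[of k S], of \<eta> "indicator A" "indicator A", symmetric]
      by (simp add: noise_form_def)
  qed
  also have "\<dots> / (2 ^ ?N * ?M) = 2 ^ k * noise_form \<eta> ?N (indicator A) (indicator A) / ?M"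
    by simp
  also have "\<dots> \<le> 2 ^ k * (real (card A) / 2 ^ ?N) powr (1 / (1 - \<eta>)) / ?M"
    using M \<eta> by (intro divide_right_mono mult_left_mono noise_form_indicator_le) (auto simp: A_def)
  finally show ?thesis by (simp only: card_A)
qed

lemma gap_arc_vectors:
  assumes "e \<in> arcs (gap_graph \<eta> k)"
  shows "\<exists>i\<^sub>0<2 ^ k. \<exists>j\<^sub>0<2 ^ k.
    gap_vec k (tail (gap_graph \<eta> k) e) i\<^sub>0 \<bullet> gap_vec k (head (gap_graph \<eta> k) e) j\<^sub>0 \<ge> 1 - 4 * \<eta> \<and>
    (\<forall>l<2 ^ k. i\<^sub>0 XOR l = gap_perm k e (j\<^sub>0 XOR l))"
proof -
  obtain f z where e: "e = prod_encode (f, z)" and z: "z \<in> good_noise \<eta> k"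
    using assms by (auto simp: gap_graph_def)
  \<comment> \<open>With the class indices as witnesses the two vectors are those of
    \<open>f\<close> and \<open>f XOR z\<close> themselves.\<close>
  have "gap_vec k (tail (gap_graph \<eta> k) e) (class_idx k f) \<bullet> gap_vec k (head (gap_graph \<eta> k) e) (class_idx k (f XOR z))
    = 1 - 2 * real (weight (2 ^ k) z) / 2 ^ k"
    by (simp add: gap_graph_def e gap_vec_def class_rep_idx cube_vec_inner_weight)
  moreover have "2 * real (weight (2 ^ k) z) / 2 ^ k \<le> 4 * \<eta>"
    using z by (simp add: good_noise_def field_simps)
  ultimately have "1 - 4 * \<eta> \<le> gap_vec k (tail (gap_graph \<eta> k) e) (class_idx k f) \<bullet>
      gap_vec k (head (gap_graph \<eta> k) e) (class_idx k (f XOR z))"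
    by linarith
  moreover have "class_idx k f XOR l = gap_perm k e (class_idx k (f XOR z) XOR l)" for l
    by (simp add: gap_perm_def e xor.commute xor.left_commute)
  ultimately show ?thesis using class_idx_less by blast
qed

lemma gap_opt_le:
  assumes \<eta>: "0 < \<eta>" "\<eta> < 1 / 2" and M: "1 / 2 \<le> good_mass \<eta> k"
    and k: "2 \<le> (2 ^ k) powr (\<eta>\<^sup>2 / (1 - \<eta>))"
  shows "ug_opt (gap_graph \<eta> k) (2 ^ k) (gap_perm k) (gap_wt \<eta> k) \<le> (2 ^ k) powr (- \<eta>)"
proof -
  have M0: "0 < good_mass \<eta> k" using M by simp
  have "(\<Sum>e\<in>satisfied_edges (gap_graph \<eta> k) (gap_perm k) lab. gap_wt \<eta> k e) \<le> (2 ^ k) powr (- \<eta>)"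
    if "lab \<in> verts (gap_graph \<eta> k) \<rightarrow>\<^sub>E {..<2 ^ k}" for lab
  proof -
    have "(\<Sum>e\<in>satisfied_edges (gap_graph \<eta> k) (gap_perm k) lab. gap_wt \<eta> k e)
      \<le> 2 ^ k * (1 / 2 ^ k) powr (1 / (1 - \<eta>)) / good_mass \<eta> k"
      using that by (intro satisfied_weight_le \<eta> M0) auto
    also have "\<dots> \<le> 2 ^ k * (1 / 2 ^ k) powr (1 / (1 - \<eta>)) / (1 / 2)"
      using M by (intro divide_left_mono) auto
    also have "\<dots> = 2 * (2 ^ k) powr (1 - 1 / (1 - \<eta>))"
      by (simp add: powr_diff powr_divide)
    \<comment> \<open>The factor 2 lost by conditioning is absorbed by the gap between the exponents
      \<open>- \<eta> / (1 - \<eta>)\<close> and \<open>- \<eta>\<close>.\<close>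
    also have "\<dots> \<le> (2 ^ k) powr (\<eta>\<^sup>2 / (1 - \<eta>)) * (2 ^ k) powr (1 - 1 / (1 - \<eta>))"
      using k by (intro mult_right_mono) auto
    also have "\<dots> = (2 ^ k) powr (\<eta>\<^sup>2 / (1 - \<eta>) + (1 - 1 / (1 - \<eta>)))"
      by (rule powr_add[symmetric])
    also have "\<eta>\<^sup>2 / (1 - \<eta>) + (1 - 1 / (1 - \<eta>)) = - \<eta>"
      using \<eta> by (simp add: divide_simps) (simp add: power2_eq_square algebra_simps)
    finally show ?thesis .
  qed
  moreover have "finite (verts (gap_graph \<eta> k) \<rightarrow>\<^sub>E {..<2 ^ k :: nat})"
    by (intro finite_PiE) (auto simp: gap_graph_def)
  moreover have "verts (gap_graph \<eta> k) \<rightarrow>\<^sub>E {..<2 ^ k :: nat} \<noteq> {}"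
    by (simp add: PiE_eq_empty_iff lessThan_empty_iff)
  ultimately show ?thesis
    unfolding ug_opt_def by (subst Max_le_iff) auto
qed

theorem theorem3p7:
  fixes \<eta> :: real
  assumes "0 < \<eta>" and "\<eta> < 1 / 2"
  shows "\<exists>N\<^sub>0::nat. \<forall>k N :: nat. N = 2 ^ k \<longrightarrow> N\<^sub>0 \<le> N \<longrightarrow>
    (\<exists>(G :: (nat, nat) pre_digraph) (\<pi> :: nat \<Rightarrow> nat \<Rightarrow> nat) (wt :: nat \<Rightarrow> real)
       (x :: nat \<Rightarrow> nat \<Rightarrow> real vec).
       unique_games G N \<pi> wt \<and>
       real (card (verts G)) = 2 ^ N / real N \<and>
       ug_opt G N \<pi> wt \<le> log 2 (real (card (verts G))) powr (- \<eta>) \<and>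
       (\<forall>v\<in>verts G. orthonormal_basis N (x v)) \<and>
       (\<forall>u\<in>verts G. \<forall>v\<in>verts G. \<forall>w\<in>verts G. \<forall>i<N. \<forall>j<N. \<forall>l<N.
          1 + x u i \<bullet> x v j \<ge> x u i \<bullet> x w l + x v j \<bullet> x w l) \<and>
       (\<forall>v\<in>verts G. \<forall>w\<in>verts G. \<forall>i<N. \<forall>j<N. \<forall>l<N.
          x v i \<bullet> x w j = x v (i XOR l) \<bullet> x w (j XOR l)) \<and>
       (\<forall>e\<in>arcs G. \<exists>i\<^sub>0<N. \<exists>j\<^sub>0<N.
          x (tail G e) i\<^sub>0 \<bullet> x (head G e) j\<^sub>0 \<ge> 1 - 4 * \<eta> \<and>
          (\<forall>l<N. i\<^sub>0 XOR l = \<pi> e (j\<^sub>0 XOR l))))"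
proof -
  \<comment> \<open>The three conditions on \<open>N\<close> control the mass of the characters, the
    Chebyshev tail, and the factor 2 in \<open>gap_opt_le\<close>, in this order.\<close>
  have "\<forall>\<^sub>F N in sequentially. real N * (1 - \<eta>) ^ N < 1 / 4"
    using assms by (intro order_tendstoD(2)[OF powser_times_n_limit_0]) auto
  moreover have "\<forall>\<^sub>F N in sequentially. 4 * (1 - \<eta>) / \<eta> \<le> real N"
    using filterlim_real_sequentially by (simp add: filterlim_at_top)
  moreover have "\<forall>\<^sub>F N in sequentially. 2 powr ((1 - \<eta>) / \<eta>\<^sup>2) \<le> real N"
    using filterlim_real_sequentially by (simp add: filterlim_at_top)
  ultimately have "\<forall>\<^sub>F N in sequentially. real N * (1 - \<eta>) ^ N < 1 / 4 \<and> 4 * (1 - \<eta>) / \<eta> \<le> real N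
      \<and> 2 powr ((1 - \<eta>) / \<eta>\<^sup>2) \<le> real N"
    by (intro eventually_conj)
  then obtain N\<^sub>0 where N\<^sub>0: "\<And>N. N\<^sub>0 \<le> N \<Longrightarrow> real N * (1 - \<eta>) ^ N < 1 / 4 \<and> 4 * (1 - \<eta>) / \<eta> \<le> real N
      \<and> 2 powr ((1 - \<eta>) / \<eta>\<^sup>2) \<le> real N"
    unfolding eventually_sequentially by blast
  show ?thesis
  proof (intro exI[of _ N\<^sub>0] allI impI)
    fix k N :: nat assume N: "N = 2 ^ k" "N\<^sub>0 \<le> N"
    note large = N\<^sub>0[OF N(2)]
    let ?G = "gap_graph \<eta> k"
    have "(1 - \<eta>) / (\<eta> * 2 ^ k) \<le> 1 / 4"
      using large assms by (simp add: N field_simps)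
    moreover have "2 ^ k * (1 - \<eta>) ^ (2 ^ k) \<le> 1 / 4" using large by (simp add: N)
    ultimately have M: "1 / 2 \<le> good_mass \<eta> k" by (rule good_mass_ge[OF assms])
    have "(2 powr ((1 - \<eta>) / \<eta>\<^sup>2)) powr (\<eta>\<^sup>2 / (1 - \<eta>)) \<le> (2 ^ k) powr (\<eta>\<^sup>2 / (1 - \<eta>))"
      using large assms by (intro powr_mono2) (auto simp: N)
    then have k: "2 \<le> (2 ^ k) powr (\<eta>\<^sup>2 / (1 - \<eta>))"
      using assms by (simp add: powr_powr)
    have "real (card (verts ?G) * 2 ^ k) = real (2 ^ N)"
      unfolding N(1) by (subst card_class_reps[symmetric]) (simp add: gap_graph_def)
    then have card: "real (card (verts ?G)) = 2 ^ N / real N"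
      by (simp add: N field_simps)
    \<comment> \<open>The logarithm is at most \<open>N\<close>, so under a negative exponent the
      bound in terms of \<open>N\<close> is the stronger one; this comparison needs the logarithm to
      be positive.\<close>
    have "log 2 (real (card (verts ?G))) = real N - real k"
      unfolding card by (simp add: log_divide log_nat_power N(1))
    moreover have "0 < real N - real k"
      using less_exp[of k] by (simp add: N(1))
    ultimately have "real N powr (- \<eta>) \<le> log 2 (real (card (verts ?G))) powr (- \<eta>)"
      using assms by (intro powr_mono2') auto
    with gap_opt_le[OF assms M k] have opt:
      "ug_opt ?G N (gap_perm k) (gap_wt \<eta> k) \<le> log 2 (real (card (verts ?G))) powr (- \<eta>)"
      by (simp add: N(1))
    have "gap_vec k v (i XOR l) \<bullet> gap_vec k w (j XOR l) = gap_vec k v i \<bullet> gap_vec k w j" for v w i j l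
      unfolding gap_vec_def character_xor xor.assoc[symmetric] by (rule cube_vec_inner_xor)
    moreover have "orthonormal_basis N (gap_vec k v)" for v
      by (rule orthonormal_basisI) (simp_all add: gap_vec_def N(1) cube_vec_orthonormal)
    ultimately show "\<exists>(G :: (nat, nat) pre_digraph) (\<pi> :: nat \<Rightarrow> nat \<Rightarrow> nat) (wt :: nat \<Rightarrow> real)
       (x :: nat \<Rightarrow> nat \<Rightarrow> real vec).
       unique_games G N \<pi> wt \<and>
       real (card (verts G)) = 2 ^ N / real N \<and>
       ug_opt G N \<pi> wt \<le> log 2 (real (card (verts G))) powr (- \<eta>) \<and>
       (\<forall>v\<in>verts G. orthonormal_basis N (x v)) \<and>
       (\<forall>u\<in>verts G. \<forall>v\<in>verts G. \<forall>w\<in>verts G. \<forall>i<N. \<forall>j<N. \<forall>l<N.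
          1 + x u i \<bullet> x v j \<ge> x u i \<bullet> x w l + x v j \<bullet> x w l) \<and>
       (\<forall>v\<in>verts G. \<forall>w\<in>verts G. \<forall>i<N. \<forall>j<N. \<forall>l<N.
          x v i \<bullet> x w j = x v (i XOR l) \<bullet> x w (j XOR l)) \<and>
       (\<forall>e\<in>arcs G. \<exists>i\<^sub>0<N. \<exists>j\<^sub>0<N.
          x (tail G e) i\<^sub>0 \<bullet> x (head G e) j\<^sub>0 \<ge> 1 - 4 * \<eta> \<and>
          (\<forall>l<N. i\<^sub>0 XOR l = \<pi> e (j\<^sub>0 XOR l)))"
      using unique_games_gap[OF assms, of k] M card opt gap_arc_vectors[of _ \<eta> k]
      by (intro exI[of _ ?G] exI[of _ "gap_perm k"] exI[of _ "gap_wt \<eta> k"] exI[of _ "gap_vec k"] conjI)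
        (simp_all add: N(1) cube_vec_triangle gap_vec_def)
  qed
qed

end
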